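(* In the needle in a haystack problem on $\{0,\dots,n-1\}$, with the sought number $s$ chosen uniformly at random from $\{0,\dots,n-1\}$ (independently of the uniformly random permutation $\sigma$ and of the strategy), every strategy, deterministic or randomized, has success probability $$\Pr[\mathcal V]\le \frac{(1+o(1))\,\log n}{n\,\log\log n},$$ where $o(1)$ denotes a quantity that depends only on $n$ (not on the strategy) and tends to $0$ as $n\to\infty$.
   Context: $\log=\log_2$. $\mathbb S_n$ is the set of all permutations of $\{0,\dots,n-1\}$. Needle in a haystack problem: a permutation $\sigma\in\mathbb S_n$ is chosen uniformly at random and a number $s\in\{0,\dots,n-1\}$ is sought. A deterministic strategy is a pair of functions: a hint function $h:\mathbb S_n\to\{0,\dots,n-1\}$, which sees $\sigma$ but not $s$, and an index function $i:\{0,\dots,n-1\}^2\to\{0,\dots,n-1\}$, which sees only the hint $h(\sigma)$ and $s$. The strategy succeeds (event $\mathcal V$) if $\sigma(i(h(\sigma),s))=s$. A randomized strategy is a probability distribution over deterministic strategies, with the strategy drawn independently of $(\sigma,s)$. $\Pr[\mathcal V]$ is the probability of success over $\sigma$, $s$ and the randomness of the strategy. *)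

theory Defs
  imports "HOL-Probability.Probability" "HOL-Combinatorics.Permutations"
begin

definition perms :: "nat \<Rightarrow> (nat \<Rightarrow> nat) set" where
  "perms n = {\<sigma>. \<sigma> permutes {..<n}}"

type_synonym strategy = "((nat \<Rightarrow> nat) \<Rightarrow> nat) \<times> (nat \<times> nat \<Rightarrow> nat)"

(* A strategy is a pair (hint function, index function). The extensional function spaces make
   strategies correspond one-to-one to pairs of functions on the finite domains, so there are
   finitely many of them and every probability distribution on strategies is a pmf. *)
definition det_strategies :: "nat \<Rightarrow> strategy set" where
  "det_strategies n =
     (perms n \<rightarrow>\<^sub>E {..<n}) \<times> ({..<n} \<times> {..<n} \<rightarrow>\<^sub>E {..<n})"

definition rand_strategies :: "nat \<Rightarrow> strategy pmf set" where
  "rand_strategies n = {D. set_pmf D \<subseteq> det_strategies n}"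

fun succeeds :: "strategy \<Rightarrow> (nat \<Rightarrow> nat) \<times> nat \<Rightarrow> bool" where
  "succeeds (h, i) (\<sigma>, s) \<longleftrightarrow> \<sigma> (i (h \<sigma>, s)) = s"

definition instance_pmf :: "nat \<Rightarrow> ((nat \<Rightarrow> nat) \<times> nat) pmf" where
  "instance_pmf n = pair_pmf (pmf_of_set (perms n)) (pmf_of_set {..<n})"

definition det_success_prob :: "nat \<Rightarrow> strategy \<Rightarrow> real" where
  "det_success_prob n S = measure_pmf.prob (instance_pmf n) {x. succeeds S x}"

definition rand_success_prob :: "nat \<Rightarrow> strategy pmf \<Rightarrow> real" where
  "rand_success_prob n D =
     measure_pmf.prob (pair_pmf D (instance_pmf n)) {(S, x). succeeds S x}"

end

theory Submission
  imports Defs "HOL-Real_Asymp.Real_Asymp"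
begin

text \<open>
  For a fixed hint \<open>j\<close> the strategy makes a fixed guess \<open>g s = i (j, s)\<close> for the position of each
  \<open>s\<close>. The number \<open>F\<close> of correct guesses has factorial moments at most those of a Poisson variable of
  mean 1, so \<open>E x\<^sup>F \<le> exp (x - 1)\<close> for \<open>x \<ge> 1\<close>. Summing over the \<open>n\<close> hints and using concavity of
  \<open>ln\<close>, the expected number of \<open>s\<close> that are found is at most \<open>(ln n + x - 1) / ln x\<close>, and
  \<open>x = 1 + ln n / ln (ln n)\<close> gives the claimed asymptotics. Randomized strategies are averages of
  deterministic ones.
\<close>

text \<open>If one such permutation \<open>\<tau>\<close> exists, composing the others with
  \<open>inv \<tau>\<close> turns them injectively into permutations that fix \<open>T\<close>
  pointwise, hence into permutations of \<open>S - T\<close>. Equality can fail because there may be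
  none, for instance when \<open>g\<close> is not injective on \<open>T\<close>.\<close>

lemma card_permutes_prescribed_le:
  assumes "finite S" "T \<subseteq> S"
  shows "card {\<sigma>. \<sigma> permutes S \<and> (\<forall>s\<in>T. \<sigma> (g s) = s)} \<le> fact (card S - card T)"
proof (cases "{\<sigma>. \<sigma> permutes S \<and> (\<forall>s\<in>T. \<sigma> (g s) = s)} = {}")
  case True
  then show ?thesis by (simp only: card.empty)
next
  case False
  define A where "A = {\<sigma>. \<sigma> permutes S \<and> (\<forall>s\<in>T. \<sigma> (g s) = s)}"
  obtain \<tau> where \<tau>: "\<tau> permutes S" "\<And>s. s \<in> T \<Longrightarrow> \<tau> (g s) = s"
    using False by auto
  have fin: "finite (S - T)" using assms by simp
  have inv: "inv \<tau> s = g s" if "s \<in> T" for s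
    using \<tau> that by (metis permutes_inverses(2))
  have "(\<lambda>\<sigma>. \<sigma> \<circ> inv \<tau>) ` A \<subseteq> {\<pi>. \<pi> permutes (S - T)}"
  proof safe
    fix \<sigma> assume "\<sigma> \<in> A"
    then have *: "\<sigma> \<circ> inv \<tau> permutes S" "\<And>s. s \<in> T \<Longrightarrow> (\<sigma> \<circ> inv \<tau>) s = s"
      using \<tau>(1) by (auto simp: A_def inv intro: permutes_compose permutes_inv)
    then show "\<sigma> \<circ> inv \<tau> permutes (S - T)"
      by (intro permutes_superset[OF *(1)]) auto
  qed
  moreover have "inj_on (\<lambda>\<sigma>. \<sigma> \<circ> inv \<tau>) A"
  proof (rule inj_onI)
    fix \<sigma> \<rho> assume "\<sigma> \<circ> inv \<tau> = \<rho> \<circ> inv \<tau>"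
    then have "\<sigma> \<circ> (inv \<tau> \<circ> \<tau>) = \<rho> \<circ> (inv \<tau> \<circ> \<tau>)"
      by (metis comp_assoc)
    then show "\<sigma> = \<rho>"
      using permutes_inv_o(2)[OF \<tau>(1)] by simp
  qed
  ultimately have "card A \<le> card {\<pi>. \<pi> permutes (S - T)}"
    using fin by (intro card_inj_on_le finite_permutations)
  also have "\<dots> = fact (card (S - T))"
    using fin by (intro card_permutations) auto
  also have "card (S - T) = card S - card T"
    using assms by (intro card_Diff_subset) (auto intro: finite_subset)
  finally show ?thesis by (simp add: A_def)
qed

lemma sum_Pow_power_card:
  fixes y :: real
  assumes "finite A"
  shows "(\<Sum>T\<in>Pow A. y ^ card T) = (1 + y) ^ card A"
  using prod_add[OF assms, of "\<lambda>_. y" "\<lambda>_. 1"] by (simp add: add.commute)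

lemma sum_Pow_card:
  fixes f :: "nat \<Rightarrow> real"
  assumes "finite A"
  shows "(\<Sum>T\<in>Pow A. f (card T)) = (\<Sum>k\<le>card A. (card A choose k) * f k)"
proof -
  have "(\<Sum>T\<in>Pow A. f (card T)) =
      (\<Sum>k\<le>card A. \<Sum>T\<in>{T \<in> Pow A. card T = k}. f (card T))"
    using assms by (intro sum.group[symmetric]) (auto intro: card_mono)
  also have "\<dots> = (\<Sum>k\<le>card A. (card A choose k) * f k)"
    using n_subsets[OF assms] by (intro sum.cong) auto
  finally show ?thesis .
qed

text \<open>The power expands into a sum of \<open>y ^ card T\<close> over all sets \<open>T\<close>
  of correct guesses. After exchanging the sums, each \<open>T\<close> is weighted by the number of
  permutations for which all guesses on \<open>T\<close> are correct.\<close>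

lemma sum_power_matches_le:
  fixes y :: real
  assumes "finite S" "0 \<le> y"
  shows "(\<Sum>\<sigma> | \<sigma> permutes S. (1 + y) ^ card {s\<in>S. \<sigma> (g s) = s}) \<le> fact (card S) * exp y"
proof -
  let ?P = "{\<sigma>. \<sigma> permutes S}"
  have finP: "finite ?P" using assms(1) by (rule finite_permutations)
  have "(\<Sum>\<sigma>\<in>?P. (1 + y) ^ card {s\<in>S. \<sigma> (g s) = s})
      = (\<Sum>\<sigma>\<in>?P. \<Sum>T\<in>Pow {s\<in>S. \<sigma> (g s) = s}. y ^ card T)"
    using assms(1) by (simp add: sum_Pow_power_card)
  also have "\<dots> = (\<Sum>\<sigma>\<in>?P. \<Sum>T\<in>{T\<in>Pow S. \<forall>s\<in>T. \<sigma> (g s) = s}. y ^ card T)"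
    by (intro sum.cong) auto
  also have "\<dots> = (\<Sum>T\<in>Pow S. \<Sum>\<sigma>\<in>{\<sigma>\<in>?P. \<forall>s\<in>T. \<sigma> (g s) = s}. y ^ card T)"
    using assms(1) finP by (intro sum.swap_restrict) auto
  also have "\<dots> = (\<Sum>T\<in>Pow S. card {\<sigma>. \<sigma> permutes S \<and> (\<forall>s\<in>T. \<sigma> (g s) = s)} * y ^ card T)"
    by simp
  also have "\<dots> \<le> (\<Sum>T\<in>Pow S. fact (card S - card T) * y ^ card T)"
  proof (intro sum_mono mult_right_mono)
    fix T assume "T \<in> Pow S"
    then show "real (card {\<sigma>. \<sigma> permutes S \<and> (\<forall>s\<in>T. \<sigma> (g s) = s)}) \<le> fact (card S - card T)"
      using card_permutes_prescribed_le[OF assms(1), of T g] of_nat_mono by fastforce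
  qed (use assms in auto)
  also have "\<dots> = (\<Sum>k\<le>card S. (card S choose k) * (fact (card S - k) * y ^ k))"
    using assms(1) by (rule sum_Pow_card)
  \<comment> \<open>Choosing \<open>k\<close> of \<open>n\<close> elements and permuting the rest
    gives \<open>n! / k!\<close>, which leaves a partial sum of the exponential series.\<close>
  also have "\<dots> = fact (card S) * (\<Sum>k\<le>card S. y ^ k / fact k)"
    by (auto simp: sum_distrib_left binomial_fact intro!: sum.cong)
  also have "(\<Sum>k\<le>card S. y ^ k / fact k) \<le> (\<Sum>k. y ^ k / fact k)"
    using summable_exp_generic[of y] assms(2)
    by (intro sum_le_suminf) (auto simp: field_simps scaleR_conv_of_real)
  also have "\<dots> = exp y"
    by (simp add: exp_def scaleR_conv_of_real field_simps)
  finally show ?thesis by simp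
qed

text \<open>The hint depends on \<open>\<sigma>\<close>, so the bound for fixed guesses does not
  apply directly. Summing over all hints costs a factor \<open>n\<close>, which becomes only the
  summand \<open>ln n\<close> after taking logarithms.\<close>

lemma sum_matches_le:
  fixes x :: real
  assumes "n > 0" "x > 1" and h: "\<And>\<sigma>. \<sigma> permutes {..<n} \<Longrightarrow> h \<sigma> < n"
  shows "(\<Sum>\<sigma> | \<sigma> permutes {..<n}. card {s\<in>{..<n}. \<sigma> (i (h \<sigma>, s)) = s})
    \<le> fact n * ((ln n + x - 1) / ln x)"
proof -
  let ?P = "{\<sigma>. \<sigma> permutes {..<n}}"
  define F where "F j \<sigma> = card {s\<in>{..<n}. \<sigma> (i (j, s)) = s}" for j \<sigma>
  define A where "A = real n * exp (x - 1)"
  have A: "A > 0" "ln A = ln n + x - 1"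
    using assms(1) by (auto simp: A_def ln_mult)
  have cardP: "card ?P = fact n" by (simp add: card_permutations)
  have "(\<Sum>\<sigma>\<in>?P. x ^ F (h \<sigma>) \<sigma>) \<le> (\<Sum>\<sigma>\<in>?P. \<Sum>j<n. x ^ F j \<sigma>)"
    using h assms(2) by (intro sum_mono member_le_sum) auto
  also have "\<dots> = (\<Sum>j<n. \<Sum>\<sigma>\<in>?P. x ^ F j \<sigma>)"
    by (rule sum.swap)
  also have "\<dots> \<le> (\<Sum>j<n. fact n * exp (x - 1))"
  proof (rule sum_mono)
    fix j
    show "(\<Sum>\<sigma>\<in>?P. x ^ F j \<sigma>) \<le> fact n * exp (x - 1)"
      using sum_power_matches_le[of "{..<n}" "x - 1" "\<lambda>s. i (j, s)"] assms(2)
      by (simp add: F_def)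
  qed
  also have "\<dots> = fact n * A" by (simp add: A_def)
  finally have mgf: "(\<Sum>\<sigma>\<in>?P. x ^ F (h \<sigma>) \<sigma>) \<le> fact n * A" .
  \<comment> \<open>Jensen's inequality by hand: \<open>ln\<close> lies below its tangent at
    \<open>A\<close>. As \<open>A\<close> bounds the average of the powers, the terms beyond
    \<open>ln A\<close> sum to at most 0.\<close>
  have "(\<Sum>\<sigma>\<in>?P. F (h \<sigma>) \<sigma> * ln x) \<le> (\<Sum>\<sigma>\<in>?P. ln A + x ^ F (h \<sigma>) \<sigma> / A - 1)"
  proof (rule sum_mono)
    fix \<sigma>
    have "F (h \<sigma>) \<sigma> * ln x - ln A = ln (x ^ F (h \<sigma>) \<sigma> / A)"
      using A(1) assms(2) by (simp add: ln_div ln_realpow)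
    also have "\<dots> \<le> x ^ F (h \<sigma>) \<sigma> / A - 1"
      using A(1) assms(2) by (intro ln_le_minus_one) auto
    finally show "F (h \<sigma>) \<sigma> * ln x \<le> ln A + x ^ F (h \<sigma>) \<sigma> / A - 1" by simp
  qed
  also have "\<dots> = fact n * ln A + (\<Sum>\<sigma>\<in>?P. x ^ F (h \<sigma>) \<sigma>) / A - fact n"
    by (simp add: sum.distrib sum_subtractf cardP sum_divide_distrib)
  also have "\<dots> \<le> fact n * ln A"
    using mgf A(1) by (simp add: field_simps)
  finally show ?thesis
    using assms(2) by (simp add: A(2) F_def flip: sum_distrib_right) (simp add: field_simps)
qed

lemma det_success_prob_eq:
  assumes "n > 0"
  shows "det_success_prob n (h, i) =
    (\<Sum>\<sigma> | \<sigma> permutes {..<n}. card {s\<in>{..<n}. \<sigma> (i (h \<sigma>, s)) = s}) / (fact n * n)"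
proof -
  have P: "finite (perms n)" "perms n \<noteq> {}" "card (perms n) = fact n"
    by (auto simp: perms_def finite_permutations card_permutations intro: permutes_id)
  have N: "{..<n} \<noteq> {}" "perms n \<times> {..<n} \<noteq> {}"
    using P assms by auto
  have "instance_pmf n = pmf_of_set (perms n \<times> {..<n})"
    unfolding instance_pmf_def using P assms
    by (intro pmf_eqI) (clarsimp simp: pmf_pair pmf_of_set indicator_def N)
  then have "det_success_prob n (h, i) =
      card ((perms n \<times> {..<n}) \<inter> {x. succeeds (h, i) x}) / (fact n * n)"
    using P N by (simp add: det_success_prob_def measure_pmf_of_set card_cartesian_product)
  also have "(perms n \<times> {..<n}) \<inter> {x. succeeds (h, i) x}
      = (SIGMA \<sigma>:perms n. {s\<in>{..<n}. \<sigma> (i (h \<sigma>, s)) = s})"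
    by auto
  finally show ?thesis
    using P by (simp add: card_SigmaI perms_def)
qed

lemma det_success_prob_le:
  fixes x :: real
  assumes "n > 0" "x > 1" "S \<in> det_strategies n"
  shows "det_success_prob n S \<le> (ln n + x - 1) / (n * ln x)"
proof -
  obtain h i where S: "S = (h, i)" by (cases S)
  then have "\<And>\<sigma>. \<sigma> permutes {..<n} \<Longrightarrow> h \<sigma> < n"
    using assms(3) by (auto simp: det_strategies_def perms_def)
  from sum_matches_le[OF assms(1,2) this, where i = i] show ?thesis
    using assms(1,2) unfolding S det_success_prob_eq[OF assms(1)]
    by (simp add: field_simps)
qed

text \<open>The strategy is independent of the instance, so conditioning on it makes the success
  probability the \<open>D\<close>-average of the deterministic ones. Working in
  \<open>ennreal\<close> avoids integrability conditions.\<close>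

lemma rand_success_prob_le:
  assumes "\<And>S. S \<in> set_pmf D \<Longrightarrow> det_success_prob n S \<le> c" "0 \<le> c"
  shows "rand_success_prob n D \<le> c"
proof -
  have "ennreal (rand_success_prob n D)
      = (\<integral>\<^sup>+ x. indicator {(S, x). succeeds S x} x \<partial>pair_pmf D (instance_pmf n))"
    by (simp add: rand_success_prob_def measure_pmf.emeasure_eq_measure)
  also have "\<dots> = (\<integral>\<^sup>+ S. ennreal (det_success_prob n S) \<partial>D)"
    by (simp add: nn_integral_pair_pmf' det_success_prob_def indicator_def
        flip: measure_pmf.emeasure_eq_measure nn_integral_indicator)
  also have "\<dots> \<le> (\<integral>\<^sup>+ S. ennreal c \<partial>D)"
    using assms by (intro nn_integral_mono_AE) (auto simp: AE_measure_pmf_iff intro: ennreal_leI)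
  also have "\<dots> = ennreal c" by simp
  finally show ?thesis using assms(2) by simp
qed

theorem theorem5:
  shows "\<exists>\<epsilon> :: nat \<Rightarrow> real. \<epsilon> \<longlonglongrightarrow> 0 \<and>
    (\<forall>n\<ge>3.
      (\<forall>S\<in>det_strategies n.
         det_success_prob n S \<le> (1 + \<epsilon> n) * log 2 (real n) / (real n * log 2 (log 2 (real n)))) \<and>
      (\<forall>D\<in>rand_strategies n.
         rand_success_prob n D \<le> (1 + \<epsilon> n) * log 2 (real n) / (real n * log 2 (log 2 (real n)))))"
proof -
  define x where "x n = 1 + ln (real n) / ln (ln (real n))" for n
  \<comment> \<open>Solved from the requirement that the claimed bound equal the deterministic one
    at \<open>x n\<close>. The limit is 0 because \<open>ln (x n)\<close> is asymptotic to
    \<open>ln (ln n)\<close>, \<open>x n - 1\<close> is negligible against \<open>ln n\<close>, and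
    changing the base of the logarithms does not affect the leading order.\<close>
  define \<epsilon> where
    "\<epsilon> n = (ln (real n) + x n - 1) / ln (x n) * log 2 (log 2 (real n)) / log 2 (real n) - 1" for n
  have "\<epsilon> \<longlonglongrightarrow> 0"
    unfolding \<epsilon>_def x_def by real_asymp
  moreover have "(\<forall>S\<in>det_strategies n.
         det_success_prob n S \<le> (1 + \<epsilon> n) * log 2 (real n) / (real n * log 2 (log 2 (real n)))) \<and>
      (\<forall>D\<in>rand_strategies n.
         rand_success_prob n D \<le> (1 + \<epsilon> n) * log 2 (real n) / (real n * log 2 (log 2 (real n))))"
    if "n \<ge> 3" for n
  proof -
    \<comment> \<open>Here \<open>n \<ge> 3\<close> matters: \<open>ln (ln n)\<close> is then
      positive, which makes \<open>x n > 1\<close>.\<close>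
    have "exp 1 < real n"
      using e_less_272 that by linarith
    then have "ln (exp 1) < ln (real n)"
      using that by (subst ln_less_cancel_iff) auto
    then have ln: "1 < ln (real n)" by simp
    then have x: "x n > 1" by (simp add: x_def)
    have log: "log 2 (real n) > 1"
      using that by simp
    then have loglog: "log 2 (log 2 (real n)) > 0"
      by simp
    \<comment> \<open>Both logarithmic factors in the definition of \<open>\<epsilon>\<close> are
      nonzero, so they cancel.\<close>
    have eq: "(1 + \<epsilon> n) * log 2 (real n) / (real n * log 2 (log 2 (real n)))
        = (ln n + x n - 1) / (n * ln (x n))"
      using log less_imp_neq[OF loglog] by (simp add: \<epsilon>_def)
    have det: "det_success_prob n S \<le> (ln n + x n - 1) / (n * ln (x n))"
      if "S \<in> det_strategies n" for S
      using det_success_prob_le[OF _ x that] \<open>n \<ge> 3\<close> by simp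
    have "0 \<le> (ln n + x n - 1) / (n * ln (x n))"
      using ln x by simp
    then show ?thesis
      unfolding eq using det by (auto simp: rand_strategies_def intro!: rand_success_prob_le)
  qed
  ultimately show ?thesis by blast
qed

end
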